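(* Let $(x_n)_{n\ge1}$ be defined by $x_1=1$ and $x_n=2x_{n-1}+\operatorname{lcm}(n,x_{n-1})$ for $n\ge2$, and for $n\ge2$ let $c_n=\frac{n}{\gcd(n,x_{n-1})}$. Assume (C1) $c_n\in\{1\}\cup\mathbb{P}$ for all $n\ge2$, and (C2) $c_p=p$ holds for infinitely many primes $p$ such that $p+2$ is also prime. Then $c_q=1$ for infinitely many primes $q$ if and only if there are infinitely many twin primes (primes $p$ with $p+2$ prime).
   Context: $\mathbb{P}$ denotes the set of prime numbers. *)

theory Defs
  imports "HOL-Computational_Algebra.Primes"
begin

end

theory Submission
  imports Defs
begin

text \<open>If \<open>c p = p\<close> then \<open>gcd p (x (p - 1)) = 1\<close>, so \<open>x p = (p + 2) * x (p - 1)\<close>. Since each term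
  divides the next, \<open>p + 2\<close> divides \<open>x (p + 1)\<close>, that is, \<open>c (p + 2) = 1\<close>. Thus (C2) sends twin pairs
  to primes \<open>q\<close> with \<open>c q = 1\<close>; it also makes the right-hand side of the equivalence true.\<close>

theorem theorem9p2:
  fixes x c :: "nat \<Rightarrow> nat"
  assumes x_1: "x 1 = 1"
    and x_rec: "\<And>n. n \<ge> 2 \<Longrightarrow> x n = 2 * x (n - 1) + lcm n (x (n - 1))"
    and c_eq: "\<And>n. n \<ge> 2 \<Longrightarrow> c n = n div gcd n (x (n - 1))"
    and C1: "\<forall>n\<ge>2. c n \<in> {1} \<union> {p. prime p}"
    and C2: "infinite {p. prime p \<and> prime (p + 2) \<and> c p = p}"
  shows "infinite {q. prime q \<and> c q = 1} \<longleftrightarrow> infinite {p::nat. prime p \<and> prime (p + 2)}"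
proof -
  let ?S = "{p. prime p \<and> prime (p + 2) \<and> c p = p}"
  have c_shift: "c (p + 2) = 1" if "prime p" "c p = p" for p
  proof -
    have p: "p \<ge> 2" using that(1) by (rule prime_ge_2_nat)
    have "p div gcd p (x (p - 1)) = p" using c_eq[OF p] that(2) by simp
    \<comment> \<open>A gcd above \<open>1\<close> would make the quotient smaller than
      \<open>p\<close>; being positive, the gcd must be \<open>1\<close>.\<close>
    moreover have "p div d < p" if "1 < d" for d :: nat
      using p that by simp
    moreover have "gcd p (x (p - 1)) > 0" using p by simp
    ultimately have "gcd p (x (p - 1)) = 1"
      by (metis less_irrefl less_one linorder_neqE_nat)
    then have "lcm p (x (p - 1)) = p * x (p - 1)"
      using prod_gcd_lcm_nat[of p "x (p - 1)"] by simp
    then have "x p = (p + 2) * x (p - 1)"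
      using x_rec[OF p] by (simp add: algebra_simps)
    \<comment> \<open>Both summands \<open>2 * x p\<close> and \<open>lcm (p + 1) (x p)\<close> are
      multiples of \<open>x p\<close>.\<close>
    moreover have "x p dvd x (p + 1)"
      using x_rec[of "p + 1"] p by simp
    ultimately have "p + 2 dvd x (p + 1)"
      using dvd_trans dvd_triv_left by metis
    then have "gcd (p + 2) (x (p + 1)) = p + 2"
      by (rule gcd_nat.absorb1)
    \<comment> \<open>Matches the index \<open>p + 2 - 1\<close> in \<open>c_eq\<close> with the
      term just treated.\<close>
    moreover have "p + 2 - 1 = p + 1" by simp
    ultimately show ?thesis
      using c_eq[of "p + 2"] by simp
  qed
  have "(\<lambda>p. p + 2) ` ?S \<subseteq> {q. prime q \<and> c q = 1}"
    using c_shift by blast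
  \<comment> \<open>The shift by \<open>2\<close> is injective, so the image stays infinite.\<close>
  moreover have "infinite ((\<lambda>p. p + 2) ` ?S)"
    using C2 by (simp add: finite_image_iff inj_on_def)
  ultimately have "infinite {q. prime q \<and> c q = 1}"
    using finite_subset by blast
  moreover have "infinite {p::nat. prime p \<and> prime (p + 2)}"
    using C2 by (rule infinite_super[rotated]) blast
  ultimately show ?thesis by blast
qed

end
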